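(* Let $G$ be a finite abelian group of order $n$ and exponent $q$ that is not isomorphic to an elementary abelian $2$-group, and let $l$ be the order of its subgroup of elements of order at most $2$. For every integer $h$ with $(n+l)/2-1\le h\le n-2$ we have $Z_h(G)=h$ if either $h=n-3$ and $q=3$, or $h=n-2$, $l=2$, and $q\equiv 2\pmod 4$; and $Z_h(G)=h+1$ otherwise.
   Context: $G$ is written additively. For $A\subseteq G$ and a positive integer $h$, $h\hat{\;}A$ denotes the set of all sums of $h$ pairwise distinct elements of $A$. $Z_h(G)=\max\{|A| : A\subseteq G,\ 0\notin h\hat{\;}A\}$. *)

theory Defs
  imports "HOL-Algebra.Algebra"
begin

text \<open>
  Groups are the multiplicative records of HOL-Algebra. A group that is written additively in
  the mathematics is rendered by reading \<open>\<otimes>\<close> as addition and \<open>\<one>\<close> as zero; a sum over a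
  finite set is then \<^const>\<open>finprod\<close>.
\<close>

definition restricted_sumset :: "('a, 'b) monoid_scheme \<Rightarrow> nat \<Rightarrow> 'a set \<Rightarrow> 'a set" where
  "restricted_sumset G h A = {(\<Otimes>\<^bsub>G\<^esub>x\<in>B. x) | B. B \<subseteq> A \<and> finite B \<and> card B = h}"

text \<open>
  For finite \<open>G\<close> and positive \<open>h\<close> the maximum ranges over a finite nonempty set, since the
  empty set \<open>A\<close> has no \<open>h\<close>-element subset. (For \<open>h = 0\<close> the only restricted sum is the empty
  sum, so the set is empty and the value carries no meaning.)
\<close>
definition max_restricted_zero_sum_free :: "('a, 'b) monoid_scheme \<Rightarrow> nat \<Rightarrow> nat" where
  "max_restricted_zero_sum_free G h =
     Max {card A | A. A \<subseteq> carrier G \<and> \<one>\<^bsub>G\<^esub> \<notin> restricted_sumset G h A}"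

definition group_exponent :: "('a, 'b) monoid_scheme \<Rightarrow> nat" where
  "group_exponent G = (LEAST m. 0 < m \<and> (\<forall>x\<in>carrier G. x [^]\<^bsub>G\<^esub> m = \<one>\<^bsub>G\<^esub>))"

text \<open>\<^const>\<open>group.ord\<close> is 0 on elements of infinite order; hence the lower bound.\<close>
definition order_at_most_2 :: "('a, 'b) monoid_scheme \<Rightarrow> 'a set" where
  "order_at_most_2 G = {x \<in> carrier G. 0 < group.ord G x \<and> group.ord G x \<le> 2}"

text \<open>The rank \<open>r = 0\<close> is allowed, so the trivial group counts as elementary abelian.\<close>
definition is_elementary_abelian_2_group :: "('a, 'b) monoid_scheme \<Rightarrow> bool" where
  "is_elementary_abelian_2_group G \<longleftrightarrow>
     (\<exists>r::nat. G \<cong> product_group {..<r} (\<lambda>_. integer_mod_group 2))"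

end

theory Submission
  imports Defs
begin

text \<open>
  Write the group additively, let \<open>s\<close> be the sum of all its elements and \<open>m = n - h - 1\<close>, so that
  \<open>1 \<le> m\<close> and \<open>2 m + l \<le> n\<close>. A set of \<open>h + 2\<close> elements with sum \<open>g\<close> has an \<open>h\<close>-term zero sum iff it
  contains distinct \<open>a, b\<close> with \<open>a + b = g\<close>; since \<open>2 a = g\<close> has at most \<open>l\<close> solutions, the involution
  \<open>a \<mapsto> g - a\<close> cannot move the whole set into its complement, so \<open>Z\<^sub>h \<le> h + 1\<close>. Passing to
  complements, \<open>Z\<^sub>h = h + 1\<close> iff some \<open>m\<close>-element set \<open>B\<close> with sum \<open>b\<close> has an element \<open>x\<close> with
  \<open>x + b = s\<close>. For \<open>m \<ge> 3\<close> such a \<open>B\<close> is found by choosing all but two elements arbitrarily and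
  counting the bad choices of the last two. For \<open>m = 2\<close> it exists unless \<open>3 x = s\<close> for all \<open>x\<close>, and
  for \<open>m = 1\<close> iff \<open>2 x = s\<close> is solvable, where \<open>s = 0\<close> unless there is exactly one involution,
  which is then \<open>s\<close>.
\<close>

context comm_group
begin

section \<open>Totals of finite sets and pairing arguments\<close>

abbreviation total :: "'a set \<Rightarrow> 'a" where
  "total A \<equiv> finprod G (\<lambda>x. x) A"

abbreviation sqrts :: "'a \<Rightarrow> 'a set" where
  "sqrts u \<equiv> {c \<in> carrier G. c \<otimes> c = u}"

lemma total_closed: "A \<subseteq> carrier G \<Longrightarrow> total A \<in> carrier G"
  by (rule finprod_closed) auto

lemma total_insert:
  assumes "finite A" "a \<notin> A" "a \<in> carrier G" "A \<subseteq> carrier G"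
  shows "total (insert a A) = a \<otimes> total A"
  using assms by (subst finprod_insert) auto

lemma total_remove:
  assumes "finite A" "A \<subseteq> carrier G" "a \<in> A"
  shows "total A = a \<otimes> total (A - {a})"
  using total_insert[of "A - {a}" a] assms by (auto simp: insert_absorb)

lemma total_Diff:
  assumes "finite (carrier G)" "B \<subseteq> carrier G"
  shows "total (carrier G) = total (carrier G - B) \<otimes> total B"
proof -
  have "finite B" using assms finite_subset by blast
  then have "total ((carrier G - B) \<union> B) = total (carrier G - B) \<otimes> total B"
    using assms by (intro finprod_Un_disjoint) auto
  moreover have "(carrier G - B) \<union> B = carrier G" using assms by auto
  ultimately show ?thesis by simp
qed

lemma eq_mult_inv_iff:
  assumes "a \<in> carrier G" "b \<in> carrier G" "g \<in> carrier G"
  shows "b = g \<otimes> inv a \<longleftrightarrow> a \<otimes> b = g"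
  using assms by (metis inv_solve_right m_comm)

text \<open>The fixed-point-free involution \<open>f\<close> cuts \<open>S\<close> into two-element
  orbits, each with product \<open>c\<close>; the induction removes one orbit at a time. It is
  applied below to inversion and to multiplication by an element of order 2.\<close>

lemma total_pairing:
  assumes "finite S" "S \<subseteq> carrier G" "c \<in> carrier G"
    and "\<And>x. x \<in> S \<Longrightarrow> f x \<in> S \<and> f (f x) = x \<and> f x \<noteq> x \<and> x \<otimes> f x = c"
  shows "even (card S) \<and> total S = c [^] (card S div 2)"
  using assms
proof (induction "card S" arbitrary: S rule: less_induct)
  case less
  show ?case
  proof (cases "S = {}")
    case False
    then obtain x where x: "x \<in> S" by auto
    define T where "T = S - {x, f x}"
    have fx: "f x \<in> S" "f x \<noteq> x" "f (f x) = x" "x \<otimes> f x = c" using less.prems(4)[OF x] by auto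
    have S: "S = insert x (insert (f x) T)" using x fx by (auto simp: T_def)
    have T: "finite T" "T \<subseteq> carrier G" "x \<notin> T" "f x \<notin> T" using less.prems by (auto simp: T_def)
    have cS: "card S = Suc (Suc (card T))" using S T fx by simp
    \<comment> \<open>\<open>T\<close> is again closed under \<open>f\<close>: if \<open>f y\<close>
      were \<open>x\<close> or \<open>f x\<close>, applying \<open>f\<close> once more would put
      \<open>y\<close> in the removed orbit.\<close>
    have "\<And>y. y \<in> T \<Longrightarrow> f y \<in> T \<and> f (f y) = y \<and> f y \<noteq> y \<and> y \<otimes> f y = c"
      using less.prems(4) x fx unfolding T_def by (metis Diff_iff insert_iff singletonD)
    then have IH: "even (card T)" "total T = c [^] (card T div 2)"
      using less.hyps[of T] T less.prems(3) cS by auto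
    have car: "x \<in> carrier G" "f x \<in> carrier G" using x fx less.prems(2) by auto
    have "total S = x \<otimes> (f x \<otimes> total T)"
      unfolding S using T car fx by (simp add: total_insert)
    also have "\<dots> = c \<otimes> total T"
      using car T fx(4) total_closed by (metis m_assoc)
    also have "\<dots> = c [^] (card S div 2)"
      using IH cS less.prems(3) by (simp add: m_comm)
    finally show ?thesis using IH cS by simp
  qed simp
qed

section \<open>Elements of order at most 2 and the total of the whole group\<close>

text \<open>Dividing by one fixed root \<open>d\<close> of \<open>u\<close> maps all roots of
  \<open>u\<close> injectively to roots of \<open>\<one>\<close>.\<close>

lemma card_sqrts_le:
  assumes "finite (carrier G)" "u \<in> carrier G"
  shows "card (sqrts u) \<le> card (sqrts \<one>)"
proof (cases "sqrts u = {}")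
  case False
  then obtain d where d: "d \<in> carrier G" "d \<otimes> d = u" by auto
  have "(c \<otimes> inv d) \<otimes> (c \<otimes> inv d) = \<one>" if "c \<in> carrier G" "c \<otimes> c = u" for c
  proof -
    have "(c \<otimes> inv d) \<otimes> (c \<otimes> inv d) = (c \<otimes> c) \<otimes> inv (d \<otimes> d)"
      using that(1) d(1) by (simp add: inv_mult m_ac)
    then show ?thesis using that d assms by simp
  qed
  then have "(\<lambda>c. c \<otimes> inv d) ` sqrts u \<subseteq> sqrts \<one>" using d by auto
  moreover have "inj_on (\<lambda>c. c \<otimes> inv d) (sqrts u)"
    using d by (auto intro!: inj_onI)
  ultimately show ?thesis using assms(1) by (intro card_inj_on_le[of "\<lambda>c. c \<otimes> inv d"]) auto
qed (metis card.empty le0)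

lemma order_at_most_2_eq:
  assumes "finite (carrier G)"
  shows "order_at_most_2 G = sqrts \<one>"
proof -
  have "0 < ord x \<and> ord x \<le> 2 \<longleftrightarrow> x \<otimes> x = \<one>" if x: "x \<in> carrier G" for x
  proof -
    have pos: "0 < ord x" using ord_ge_1[OF assms x] by simp
    have "x \<otimes> x = \<one> \<longleftrightarrow> ord x dvd 2"
      using pow_eq_id[OF x, of 2] x by (simp add: numeral_2_eq_2)
    also have "\<dots> \<longleftrightarrow> ord x \<le> 2"
    proof
      assume "ord x \<le> 2"
      then have "ord x = 1 \<or> ord x = 2" using pos by linarith
      then show "ord x dvd 2" by auto
    qed (simp add: dvd_imp_le)
    finally show ?thesis using pos by simp
  qed
  then show ?thesis by (auto simp: order_at_most_2_def)
qed

text \<open>Every element outside \<open>sqrts \<one>\<close> cancels against its inverse, which is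
  a different element.\<close>

lemma total_carrier_eq_total_sqrts:
  assumes fin: "finite (carrier G)"
  shows "total (carrier G) = total (sqrts \<one>)"
proof -
  let ?S = "carrier G - sqrts \<one>"
  have "inv x \<in> ?S \<and> inv (inv x) = x \<and> inv x \<noteq> x \<and> x \<otimes> inv x = \<one>" if "x \<in> ?S" for x
  proof -
    have x: "x \<in> carrier G" "x \<otimes> x \<noteq> \<one>" using that by auto
    then have "inv x \<noteq> x" by (metis r_inv)
    moreover have "inv x \<otimes> inv x \<noteq> \<one>"
      using x by (metis inv_inv inv_mult_group inv_one m_closed)
    ultimately show ?thesis using x by simp
  qed
  then have "total ?S = \<one> [^] (card ?S div 2)"
    using total_pairing[of ?S \<one> "\<lambda>x. inv x"] fin by auto
  then show ?thesis
    using total_Diff[OF fin, of "sqrts \<one>"] total_closed[of "sqrts \<one>"] by auto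
qed

text \<open>Multiplication by \<open>z\<close> pairs \<open>x\<close> with
  \<open>x \<otimes> z\<close>, and the product of such a pair is \<open>z\<close> because
  \<open>x \<otimes> x = \<one>\<close>.\<close>

lemma total_sqrts_one:
  assumes fin: "finite (carrier G)" and z: "z \<in> sqrts \<one>" "z \<noteq> \<one>"
  shows "even (card (sqrts \<one>)) \<and> total (sqrts \<one>) = z [^] (card (sqrts \<one>) div 2)"
proof (rule total_pairing[where f = "\<lambda>x. x \<otimes> z"])
  fix x assume x: "x \<in> sqrts \<one>"
  have "x \<otimes> z \<otimes> (x \<otimes> z) = (x \<otimes> x) \<otimes> (z \<otimes> z)" using x z by (simp add: m_ac)
  moreover have "x \<otimes> z \<otimes> z = x" "x \<otimes> (x \<otimes> z) = z"
    using x z by (auto simp: m_assoc) (auto simp flip: m_assoc)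
  moreover have "x \<otimes> z \<noteq> x" using x z by simp
  ultimately show "x \<otimes> z \<in> sqrts \<one> \<and> x \<otimes> z \<otimes> z = x \<and> x \<otimes> z \<noteq> x \<and> x \<otimes> (x \<otimes> z) = z"
    using x z by auto
qed (use assms in auto)

lemma pow_sqrt_one:
  assumes "z \<in> sqrts \<one>"
  shows "z [^] (k::nat) = (if even k then \<one> else z)"
  using assms by (induction k) auto

lemma total_carrier_eq_one:
  assumes fin: "finite (carrier G)" and l: "card (sqrts \<one>) \<noteq> 2"
  shows "total (carrier G) = \<one>"
proof (cases "sqrts \<one> = {\<one>}")
  case True
  then show ?thesis using total_carrier_eq_total_sqrts[OF fin] by simp
next
  case False
  then obtain z where z: "z \<in> sqrts \<one>" "z \<noteq> \<one>" by auto
  have "sqrts \<one> \<noteq> {\<one>, z}" using l z by auto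
  then obtain w where w: "w \<in> sqrts \<one>" "w \<noteq> \<one>" "w \<noteq> z" using z by auto
  let ?k = "card (sqrts \<one>) div 2"
  have "total (sqrts \<one>) = z [^] ?k" "total (sqrts \<one>) = w [^] ?k"
    using total_sqrts_one[OF fin z] total_sqrts_one[OF fin w(1,2)] by blast+
  \<comment> \<open>Both powers have the same exponent \<open>?k\<close>; if it were odd, they would
    give \<open>z = w\<close>.\<close>
  then have "total (sqrts \<one>) = \<one>"
    unfolding pow_sqrt_one[OF z(1)] pow_sqrt_one[OF w(1)] using w(3) by (cases "even ?k") simp_all
  then show ?thesis using total_carrier_eq_total_sqrts[OF fin] by simp
qed

lemma total_carrier_involution:
  assumes fin: "finite (carrier G)" and l: "card (sqrts \<one>) = 2"
    and z: "z \<in> sqrts \<one>" "z \<noteq> \<one>"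
  shows "total (carrier G) = z"
  using total_sqrts_one[OF fin z] total_carrier_eq_total_sqrts[OF fin] l pow_sqrt_one[OF z(1)] z
  by simp

section \<open>Restricted products from sets of \<open>h + 1\<close> and \<open>h + 2\<close>
  elements\<close>

text \<open>The \<open>h\<close>-element subsets are the sets \<open>A - {a}\<close>, and such a set
  has total \<open>\<one>\<close> exactly when \<open>a = total A\<close>.\<close>

lemma one_in_restricted_sumset_Suc:
  assumes A: "finite A" "A \<subseteq> carrier G" "card A = Suc h"
  shows "\<one> \<in> restricted_sumset G h A \<longleftrightarrow> total A \<in> A"
proof
  assume "\<one> \<in> restricted_sumset G h A"
  then obtain B where B: "total B = \<one>" "B \<subseteq> A" "finite B" "card B = h"
    by (auto simp: restricted_sumset_def)
  then have "card (A - B) = 1" using A by (simp add: card_Diff_subset)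
  then obtain a where "A - B = {a}" by (auto simp: card_1_singleton_iff)
  then have "a \<in> A" "A - {a} = B" using B(2) by auto
  then have "total A = a" using total_remove[OF A(1,2), of a] A(2) B(1) by (metis r_one subsetD)
  then show "total A \<in> A" using \<open>a \<in> A\<close> by simp
next
  assume t: "total A \<in> A"
  let ?a = "total A"
  have "total (A - {?a}) \<in> carrier G" using A by (auto intro: total_closed)
  then have "total (A - {?a}) = \<one>"
    using total_remove[OF A(1,2) t] t A(2) l_cancel_one'[of ?a "total (A - {?a})"] by blast
  moreover have "card (A - {?a}) = h" using A t by simp
  ultimately show "\<one> \<in> restricted_sumset G h A"
    unfolding restricted_sumset_def using A(1) 
    by (intro CollectI exI[of _ "A - {?a}"]) auto
qed

lemma one_in_restricted_sumset_Suc_Suc: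
  assumes fin: "finite (carrier G)" and A: "A \<subseteq> carrier G" "card A = h + 2"
    and h: "order G + card (sqrts \<one>) \<le> 2 * h + 2"
  shows "\<one> \<in> restricted_sumset G h A"
proof (rule ccontr)
  assume not: "\<one> \<notin> restricted_sumset G h A"
  have finA: "finite A" using A fin finite_subset by blast
  define g where "g = total A"
  have g: "g \<in> carrier G" using A total_closed g_def by simp
  have no_pair: "a \<otimes> b \<noteq> g" if ab: "a \<in> A" "b \<in> A" "a \<noteq> b" for a b
  proof
    assume eq: "a \<otimes> b = g"
    have car: "a \<in> carrier G" "b \<in> carrier G" "total (A - {a} - {b}) \<in> carrier G"
      using ab A by (auto intro!: total_closed)
    have "total (A - {a}) = b \<otimes> total (A - {a} - {b})"
      using ab finA A by (intro total_remove) auto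
    then have "g = a \<otimes> (b \<otimes> total (A - {a} - {b}))"
      unfolding g_def using total_remove[OF finA A(1) ab(1)] by metis
    then have "total (A - {a} - {b}) = \<one>"
      using car eq g l_cancel_one'[of g "total (A - {a} - {b})"] by (simp add: m_assoc[symmetric])
    moreover have "card (A - {a} - {b}) = h" using ab A finA by simp
    ultimately have "\<one> \<in> restricted_sumset G h A"
      unfolding restricted_sumset_def using finA
      by (intro CollectI exI[of _ "A - {a} - {b}"]) auto
    with not show False by simp
  qed
  \<comment> \<open>For \<open>a\<close> in \<open>A\<close> with
    \<open>a \<otimes> a \<noteq> g\<close>, the partner \<open>g \<otimes> inv a\<close> differs
    from \<open>a\<close>, so by \<open>no_pair\<close> it lies outside \<open>A\<close>.\<close>
  have "g \<otimes> inv a \<in> carrier G - A" if "a \<in> A - sqrts g" for a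
  proof -
    have a: "a \<in> A" "a \<in> carrier G" "a \<otimes> a \<noteq> g" using that A by auto
    have "a \<otimes> (g \<otimes> inv a) = g" using eq_mult_inv_iff[of a "g \<otimes> inv a" g] a g by simp
    then show ?thesis using no_pair[of a "g \<otimes> inv a"] a g by (metis DiffI inv_closed m_closed)
  qed
  moreover have "inj_on (\<lambda>a. g \<otimes> inv a) (A - sqrts g)"
  proof (rule inj_onI)
    fix x y assume "x \<in> A - sqrts g" "y \<in> A - sqrts g" and eq: "g \<otimes> inv x = g \<otimes> inv y"
    then have "x \<in> carrier G" "y \<in> carrier G" using A by auto
    then show "x = y" using eq g by (simp add: inv_inj[THEN inj_on_eq_iff])
  qed
  ultimately have "card (A - sqrts g) \<le> card (carrier G - A)"
    using fin by (intro card_inj_on_le[of "\<lambda>a. g \<otimes> inv a"]) auto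
  moreover have "card (carrier G - A) = order G - card A"
    using A finA by (simp add: card_Diff_subset order_def)
  moreover have "card A - card (sqrts g) \<le> card (A - sqrts g)"
    using fin by (intro diff_card_le_card_Diff) auto
  moreover have "card (sqrts g) \<le> card (sqrts \<one>)" by (rule card_sqrts_le[OF fin g])
  moreover have "card A \<le> order G" unfolding order_def using fin A card_mono by blast
  \<comment> \<open>With n the group order and l the number of roots of \<open>\<one>\<close>, the
    bounds give 2 h + 4 \<le> n + l, against n + l \<le> 2 h + 2.\<close>
  ultimately show False using h A by linarith
qed

text \<open>Removing two different elements from a set of \<open>h + 1\<close> elements leaves
  different totals, so they are not both \<open>\<one>\<close>. The resulting set has only itself as
  an \<open>h\<close>-element subset, so it shows that the maximum is at least
  \<open>h\<close>.\<close>

lemma ex_total_ne_one: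
  assumes fin: "finite (carrier G)" and h: "0 < h" "h < order G"
  obtains A where "A \<subseteq> carrier G" "card A = h" "total A \<noteq> \<one>"
proof -
  obtain C where C: "C \<subseteq> carrier G" "card C = Suc h" "finite C"
    using h obtain_subset_with_card_n[of "Suc h" "carrier G"] unfolding order_def by auto
  have "\<not> is_singleton C" "C \<noteq> {}" using C h by (auto simp: is_singleton_altdef)
  then obtain a b where ab: "a \<in> C" "b \<in> C" "a \<noteq> b"
    by (metis is_singletonI' )
  have car: "a \<in> carrier G" "b \<in> carrier G" using ab C by auto
  have "total (C - {a}) \<noteq> \<one> \<or> total (C - {b}) \<noteq> \<one>"
    using total_remove[OF C(3,1), of a] total_remove[OF C(3,1), of b] ab car by auto
  moreover have "card (C - {a}) = h" "card (C - {b}) = h" using C ab by auto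
  ultimately show ?thesis using that[of "C - {a}"] that[of "C - {b}"] C by auto
qed

section \<open>Passing to complements\<close>

text \<open>Take \<open>B\<close> to be the complement of \<open>A\<close> and
  \<open>x = total A\<close>: the totals of \<open>A\<close> and \<open>B\<close> multiply to that
  of the group, and \<open>x\<close> is outside \<open>A\<close> iff it is in
  \<open>B\<close>.\<close>

lemma ex_total_notin_iff:
  assumes fin: "finite (carrier G)" and n: "order G = k + m"
  shows "(\<exists>A\<subseteq>carrier G. card A = k \<and> total A \<notin> A) \<longleftrightarrow>
    (\<exists>B\<subseteq>carrier G. card B = m \<and> (\<exists>x\<in>B. x \<otimes> total B = total (carrier G)))"
    (is "?L \<longleftrightarrow> ?R")
proof
  assume ?L
  then obtain A where A: "A \<subseteq> carrier G" "card A = k" "total A \<notin> A" by auto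
  have "total (carrier G) = total A \<otimes> total (carrier G - A)"
    using total_Diff[OF fin, of "carrier G - A"] A(1) by (simp add: double_diff)
  moreover have "card (carrier G - A) = m"
    using A n fin finite_subset[OF A(1)] by (simp add: card_Diff_subset order_def)
  moreover have "total A \<in> carrier G - A" using A total_closed by auto
  ultimately show ?R by (metis Diff_subset)
next
  assume ?R
  then obtain B x where B: "B \<subseteq> carrier G" "card B = m" "x \<in> B"
    and x: "x \<otimes> total B = total (carrier G)" by auto
  have "total (carrier G - B) = x"
    using total_Diff[OF fin B(1)] x B total_closed[of "carrier G - B"] total_closed[OF B(1)]
    by (metis Diff_subset r_cancel subsetD)
  moreover have "card (carrier G - B) = k"
    using B n fin finite_subset[OF B(1)] by (simp add: card_Diff_subset order_def)
  ultimately show ?L using B(3) by (metis DiffD2 Diff_subset)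
qed

section \<open>Sets of at least three elements\<close>

text \<open>Fix \<open>m - 2\<close> elements \<open>D\<close> and some \<open>x\<close> in
  \<open>D\<close>, which exists since \<open>m \<ge> 3\<close>. Two further elements
  \<open>c\<close> and \<open>y\<close> then only have to satisfy one equation, and counting leaves
  a free choice of \<open>c\<close>.\<close>

lemma ex_set_mult_total:
  assumes fin: "finite (carrier G)" and s: "s \<in> carrier G"
    and m: "3 \<le> m" "2 * m + card (sqrts \<one>) \<le> order G"
  shows "\<exists>B\<subseteq>carrier G. card B = m \<and> (\<exists>x\<in>B. x \<otimes> total B = s)"
proof -
  have "m - 2 \<le> card (carrier G)" using m by (simp add: order_def)
  then obtain D where D: "D \<subseteq> carrier G" "card D = m - 2" "finite D"
    using obtain_subset_with_card_n by metis
  then obtain x where xD: "x \<in> D" using m by fastforce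
  have x: "x \<in> carrier G" using xD D by auto
  \<comment> \<open>\<open>u\<close> is the value that \<open>c \<otimes> y\<close> must take for
    the enlarged set to satisfy the equation with \<open>x\<close>.\<close>
  define u where "u = s \<otimes> inv (x \<otimes> total D)"
  have tD: "total D \<in> carrier G" using D total_closed by simp
  have u: "u \<in> carrier G" using s x tD by (simp add: u_def)
  \<comment> \<open>The three parts exclude in turn \<open>c \<in> D\<close>,
    \<open>y \<in> D\<close> and \<open>y = c\<close>, where
    \<open>y = u \<otimes> inv c\<close>.\<close>
  let ?bad = "D \<union> (\<lambda>d. u \<otimes> inv d) ` D \<union> sqrts u"
  have "card ?bad \<le> card D + card D + card (sqrts \<one>)"
    using card_Un_le[of "D \<union> (\<lambda>d. u \<otimes> inv d) ` D" "sqrts u"] card_sqrts_le[OF fin u]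
      card_Un_le[of D "(\<lambda>d. u \<otimes> inv d) ` D"] card_image_le[OF D(3), of "\<lambda>d. u \<otimes> inv d"]
    by linarith
  \<comment> \<open>The bound is 2 (m - 2) plus the number of roots of \<open>\<one>\<close>, which
    is at most \<open>order G - 4\<close>.\<close>
  also have "\<dots> < card (carrier G)" using D m by (simp add: order_def)
  finally have "card ?bad < card (carrier G)" .
  then have "\<not> carrier G \<subseteq> ?bad"
    using card_mono[of ?bad "carrier G"] D fin by auto
  then obtain c where c: "c \<in> carrier G" "c \<notin> ?bad" by auto
  define y where "y = u \<otimes> inv c"
  have y: "y \<in> carrier G" using u c by (simp add: y_def)
  have cy: "c \<otimes> y = u" using eq_mult_inv_iff[of c y u] c u y y_def by simp
  have "y \<noteq> c" using cy c by auto
  moreover have "y \<notin> D"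
  proof
    assume "y \<in> D"
    moreover have "c = u \<otimes> inv y" using eq_mult_inv_iff[of y c u] cy c u y by (simp add: m_comm)
    ultimately show False using c by auto
  qed
  ultimately have yi: "y \<notin> insert c D" by auto
  let ?B = "insert y (insert c D)"
  have "total ?B = y \<otimes> (c \<otimes> total D)"
    using yi c y D by (simp add: total_insert)
  then have "x \<otimes> total ?B = (c \<otimes> y) \<otimes> (x \<otimes> total D)"
    using x y c(1) tD by (simp add: m_ac)
  also have "\<dots> = s" unfolding cy u_def using s x tD by (simp add: m_assoc)
  finally have "x \<otimes> total ?B = s" .
  moreover have "card ?B = m" using yi c D m by simp
  moreover have "?B \<subseteq> carrier G" using y c D by auto
  ultimately show ?thesis using xD by blast
qed

section \<open>The exponent and sets of one or two elements\<close>

lemma group_exponent_spec: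
  assumes fin: "finite (carrier G)"
  shows "0 < group_exponent G" "\<And>x. x \<in> carrier G \<Longrightarrow> x [^] group_exponent G = \<one>"
    "\<And>k. 0 < k \<Longrightarrow> \<forall>x\<in>carrier G. x [^] k = \<one> \<Longrightarrow> group_exponent G \<le> k"
proof -
  let ?P = "\<lambda>m::nat. 0 < m \<and> (\<forall>x\<in>carrier G. x [^] m = \<one>)"
  have "?P (order G)" using fin order_gt_0_iff_finite pow_order_eq_1 by blast
  then have "?P (group_exponent G)" unfolding group_exponent_def by (rule LeastI)
  then show "0 < group_exponent G" "\<And>x. x \<in> carrier G \<Longrightarrow> x [^] group_exponent G = \<one>" by auto
  show "\<And>k. 0 < k \<Longrightarrow> \<forall>x\<in>carrier G. x [^] k = \<one> \<Longrightarrow> group_exponent G \<le> k"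
    unfolding group_exponent_def by (rule Least_le) blast
qed

text \<open>Only the case of a unique element \<open>z\<close> of order 2 is in doubt, where the
  total is \<open>z\<close>. A root \<open>x\<close> of \<open>z\<close> would give
  \<open>x [^] q = z [^] (q div 2)\<close>, which is \<open>z\<close> for
  \<open>q mod 4 = 2\<close>. If 4 divides \<open>q\<close>, a root comes from an element not
  annihilated by \<open>q div 2\<close>.\<close>

lemma ex_sqrt_total_carrier_iff:
  assumes fin: "finite (carrier G)"
  shows "(\<exists>x\<in>carrier G. x \<otimes> x = total (carrier G)) \<longleftrightarrow>
    \<not> (card (sqrts \<one>) = 2 \<and> group_exponent G mod 4 = 2)"
proof (cases "card (sqrts \<one>) = 2")
  case False
  then have "\<one> \<otimes> \<one> = total (carrier G)" using total_carrier_eq_one fin by simp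
  then show ?thesis using False by blast
next
  case True
  have "sqrts \<one> \<noteq> {\<one>}" using True by auto
  then obtain z where z: "z \<in> sqrts \<one>" "z \<noteq> \<one>" by auto
  have L: "sqrts \<one> = {\<one>, z}"
    using card_subset_eq[of "sqrts \<one>" "{\<one>, z}"] z True fin by auto
  have s: "total (carrier G) = z" using total_carrier_involution[OF fin True z] .
  let ?q = "group_exponent G"
  note q = group_exponent_spec[OF fin]
  have "z [^] ?q = \<one>" using q(2) z by auto
  then have ev: "even ?q" using pow_sqrt_one[OF z(1)] z(2) by metis
  show ?thesis
  proof (cases "?q mod 4 = 2")
    case c: True
    then have qh: "?q = 2 * (?q div 2)" "odd (?q div 2)" by presburger+
    have "x \<otimes> x \<noteq> z" if x: "x \<in> carrier G" for x
    proof
      assume xz: "x \<otimes> x = z"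
      have "x [^] ?q = (x [^] (2::nat)) [^] (?q div 2)"
        using x qh(1) by (metis nat_pow_pow)
      also have "\<dots> = z"
        using xz x pow_sqrt_one[OF z(1)] qh(2) by (simp add: numeral_2_eq_2)
      finally show False using q(2)[OF x] z(2) by simp
    qed
    then show ?thesis using c True s by auto
  next
    case c: False
    with ev have q4: "?q = 4 * (?q div 4)" by presburger
    \<comment> \<open>Here \<open>2 * (?q div 4)\<close> is half the exponent, so by minimality some
      \<open>y\<close> does not have it as a period. That power of \<open>y\<close> squares to
      \<open>\<one>\<close>, hence is \<open>z\<close>, and \<open>y [^] (?q div 4)\<close> is a
      root of it.\<close>
    have "0 < 2 * (?q div 4)" "2 * (?q div 4) < ?q" using q(1) q4 by linarith+
    then obtain y where y: "y \<in> carrier G" "y [^] (2 * (?q div 4)) \<noteq> \<one>"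
      using q(3)[of "2 * (?q div 4)"] by fastforce
    define x where "x = y [^] (?q div 4)"
    have x: "x \<in> carrier G" using y by (simp add: x_def)
    have xx: "x \<otimes> x = y [^] (2 * (?q div 4))"
      using y by (simp add: x_def nat_pow_mult mult_2)
    have "(x \<otimes> x) \<otimes> (x \<otimes> x) = y [^] ?q"
      unfolding xx using y q4 by (simp add: nat_pow_mult)
    then have "x \<otimes> x \<in> sqrts \<one>" using x q(2)[OF y(1)] by auto
    then have "x \<otimes> x = z" using L xx y(2) by auto
    then show ?thesis using c s x by auto
  qed
qed

text \<open>Each \<open>x\<close> determines \<open>y\<close>, and \<open>y = x\<close> means that
  the cube of \<open>x\<close> is the total. So the equation fails to be solvable with
  \<open>x \<noteq> y\<close> only if all cubes equal the total, which for a nontrivial group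
  amounts to exponent 3.\<close>

lemma ex_pair_total_carrier_iff:
  assumes fin: "finite (carrier G)" and n: "1 < order G"
  shows "(\<exists>x\<in>carrier G. \<exists>y\<in>carrier G. x \<noteq> y \<and> x \<otimes> (x \<otimes> y) = total (carrier G)) \<longleftrightarrow>
    group_exponent G \<noteq> 3"
proof -
  let ?q = "group_exponent G" and ?s = "total (carrier G)"
  note q = group_exponent_spec[OF fin]
  have s: "?s \<in> carrier G" using total_closed by simp
  have cube: "x [^] (3::nat) = x \<otimes> (x \<otimes> x)" if "x \<in> carrier G" for x
    using that by (simp add: numeral_3_eq_3 m_assoc)
  have "(\<exists>x\<in>carrier G. \<exists>y\<in>carrier G. x \<noteq> y \<and> x \<otimes> (x \<otimes> y) = ?s) \<longleftrightarrow>
    (\<exists>x\<in>carrier G. x [^] (3::nat) \<noteq> ?s)"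
  proof
    assume "\<exists>x\<in>carrier G. \<exists>y\<in>carrier G. x \<noteq> y \<and> x \<otimes> (x \<otimes> y) = ?s"
    then show "\<exists>x\<in>carrier G. x [^] (3::nat) \<noteq> ?s" using cube by (metis l_cancel m_closed)
  next
    assume "\<exists>x\<in>carrier G. x [^] (3::nat) \<noteq> ?s"
    then obtain x where x: "x \<in> carrier G" "x \<otimes> (x \<otimes> x) \<noteq> ?s" using cube by metis
    let ?y = "inv x \<otimes> (inv x \<otimes> ?s)"
    have "x \<otimes> (x \<otimes> ?y) = ?s" using x(1) s by (simp flip: m_assoc)
    moreover have "?y \<in> carrier G" using x s by simp
    ultimately show "\<exists>x\<in>carrier G. \<exists>y\<in>carrier G. x \<noteq> y \<and> x \<otimes> (x \<otimes> y) = ?s"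
      using x by metis
  qed
  also have "\<dots> \<longleftrightarrow> ?q \<noteq> 3"
  proof
    assume "\<exists>x\<in>carrier G. x [^] (3::nat) \<noteq> ?s"
    then obtain x where x: "x \<in> carrier G" "x [^] (3::nat) \<noteq> ?s" by auto
    show "?q \<noteq> 3"
    proof
      assume q3: "?q = 3"
      \<comment> \<open>Exponent 3 leaves no element of order 2, so the total is
        \<open>\<one>\<close>, which is then every cube.\<close>
      have "y = \<one>" if "y \<in> carrier G" "y \<otimes> y = \<one>" for y
        using q(2)[OF that(1)] cube[OF that(1)] that q3 by simp
      then have "sqrts \<one> = {\<one>}" by auto
      then have "?s = \<one>" using total_carrier_eq_one[OF fin] by simp
      then show False using q(2)[OF x(1)] x q3 by simp
    qed
  next
    assume q3: "?q \<noteq> 3"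
    show "\<exists>x\<in>carrier G. x [^] (3::nat) \<noteq> ?s"
    proof (rule ccontr)
      assume "\<not> ?thesis"
      then have all: "x [^] (3::nat) = ?s" if "x \<in> carrier G" for x using that by auto
      \<comment> \<open>The cube of \<open>\<one>\<close> identifies the constant value, so all
        cubes are \<open>\<one>\<close>. Together with exponent 1 or 2 this would make the group
        trivial.\<close>
      then have "?s = \<one>" using all[of \<one>] by simp
      with all have all1: "x [^] (3::nat) = \<one>" if "x \<in> carrier G" for x using that by auto
      then have "?q \<le> 3" using q(3)[of 3] by auto
      then have "?q = 1 \<or> ?q = 2" using q(1) q3 by linarith
      then have "x = \<one>" if "x \<in> carrier G" for x
      proof
        assume "?q = 1"
        then show ?thesis using q(2)[OF that] that by simp
      next
        assume "?q = 2"
        then have "x \<otimes> x = \<one>" using q(2)[OF that] that by (simp add: numeral_2_eq_2)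
        then show ?thesis using all1[OF that] cube[OF that] that by simp
      qed
      then have "carrier G = {\<one>}" by auto
      then show False using n by (simp add: order_def)
    qed
  qed
  finally show ?thesis .
qed

text \<open>A singleton leads to \<open>x \<otimes> x\<close>, a pair to
  \<open>x \<otimes> (x \<otimes> y)\<close>, each with its own exception; from three elements on
  there is none.\<close>

lemma ex_set_mult_total_carrier_iff:
  assumes fin: "finite (carrier G)"
    and m: "1 \<le> m" "2 * m + card (sqrts \<one>) \<le> order G"
  shows "(\<exists>B\<subseteq>carrier G. card B = m \<and> (\<exists>x\<in>B. x \<otimes> total B = total (carrier G))) \<longleftrightarrow>
    \<not> (m = 2 \<and> group_exponent G = 3 \<or>
       m = 1 \<and> card (sqrts \<one>) = 2 \<and> group_exponent G mod 4 = 2)"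
    (is "?L \<longleftrightarrow> _")
proof -
  consider "m = 1" | "m = 2" | "3 \<le> m" using m by linarith
  then show ?thesis
  proof cases
    case 1
    have "?L \<longleftrightarrow> (\<exists>x\<in>carrier G. x \<otimes> x = total (carrier G))"
    proof
      assume ?L
      then show "\<exists>x\<in>carrier G. x \<otimes> x = total (carrier G)"
        using 1 by (auto simp: card_1_singleton_iff)
    next
      assume "\<exists>x\<in>carrier G. x \<otimes> x = total (carrier G)"
      then obtain x where "x \<in> carrier G" "x \<otimes> x = total (carrier G)" by auto
      then show ?L using 1 by (intro exI[of _ "{x}"]) auto
    qed
    then show ?thesis using ex_sqrt_total_carrier_iff[OF fin] 1 by simp
  next
    case 2
    have "?L \<longleftrightarrow>
      (\<exists>x\<in>carrier G. \<exists>y\<in>carrier G. x \<noteq> y \<and> x \<otimes> (x \<otimes> y) = total (carrier G))" (is "_ \<longleftrightarrow> ?R")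
    proof
      assume ?L
      then obtain B x where B: "B \<subseteq> carrier G" "card B = 2" "x \<in> B"
        "x \<otimes> total B = total (carrier G)" using 2 by auto
      have finB: "finite B" using B(1) fin finite_subset by blast
      have "card (B - {x}) = 1" using B finB by simp
      then obtain y where y: "B - {x} = {y}" by (auto simp: card_1_singleton_iff)
      then have ny: "y \<in> carrier G" "x \<noteq> y" using B(1) by auto
      then have "total B = x \<otimes> y" using total_remove[OF finB B(1,3)] unfolding y by simp
      then show ?R using B ny by auto
    next
      assume ?R
      then obtain x y where xy: "x \<in> carrier G" "y \<in> carrier G" "x \<noteq> y"
        "x \<otimes> (x \<otimes> y) = total (carrier G)" by auto
      then have "total {x, y} = x \<otimes> y" by (simp add: total_insert)
      then show ?L using 2 xy by (intro exI[of _ "{x, y}"]) auto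
    qed
    then show ?thesis using ex_pair_total_carrier_iff[OF fin] m 2 by simp
  next
    case 3
    then show ?thesis using ex_set_mult_total[OF fin _ 3 m(2)] total_closed by auto
  qed
qed

section \<open>Evaluation of the maximum\<close>

text \<open>Avoiding \<open>\<one>\<close> is inherited by subsets, so excluding sets of
  \<open>h + 2\<close> elements bounds all sizes by \<open>h + 1\<close>. The value \<open>h\<close>
  is always reached, and \<open>h + 1\<close> is reached iff some set of that size does not contain
  its total.\<close>

lemma max_restricted_zero_sum_free_eq:
  assumes fin: "finite (carrier G)" and h: "0 < h" "h < order G"
    and nl: "order G + card (sqrts \<one>) \<le> 2 * h + 2"
  shows "max_restricted_zero_sum_free G h =
    (if \<exists>A\<subseteq>carrier G. card A = h + 1 \<and> total A \<notin> A then h + 1 else h)"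
proof -
  let ?free = "\<lambda>A. A \<subseteq> carrier G \<and> \<one> \<notin> restricted_sumset G h A"
  let ?S = "{card A | A. ?free A}"
  have fins: "finite A" if "A \<subseteq> carrier G" for A using that fin finite_subset by blast
  have anti: "?free B" if "?free A" "B \<subseteq> A" for A B
    using that unfolding restricted_sumset_def by blast
  have le: "card A \<le> h + 1" if A: "?free A" for A
  proof (rule ccontr)
    assume "\<not> card A \<le> h + 1"
    then obtain B where "B \<subseteq> A" "card B = h + 2"
      using obtain_subset_with_card_n[of "h + 2" A] by auto
    then show False
      using anti[OF A, of B] one_in_restricted_sumset_Suc_Suc[OF fin _ _ nl, of B] by auto
  qed
  then have finS: "finite ?S" by (intro finite_subset[of ?S "{..h + 1}"]) auto
  show ?thesis
  proof (cases "\<exists>A\<subseteq>carrier G. card A = h + 1 \<and> total A \<notin> A")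
    case True
    then obtain A where A: "A \<subseteq> carrier G" "card A = h + 1" "total A \<notin> A" by auto
    then have "?free A" using one_in_restricted_sumset_Suc[of A h] fins by auto
    then have "card A \<in> ?S" by blast
    then have "h + 1 \<in> ?S" unfolding A(2) .
    then have "Max ?S = h + 1" using le finS by (intro Max_eqI) auto
    then show ?thesis using True unfolding max_restricted_zero_sum_free_def by simp
  next
    case False
    have le': "card A \<le> h" if A: "?free A" for A
    proof (rule ccontr)
      assume "\<not> card A \<le> h"
      then have "card A = h + 1" using le[OF A] by simp
      then show False using A False one_in_restricted_sumset_Suc[of A h] fins by auto
    qed
    obtain A where A: "A \<subseteq> carrier G" "card A = h" "total A \<noteq> \<one>"
      using ex_total_ne_one[OF fin h] by blast
    have eq: "B = A" if "B \<subseteq> A" "card B = h" for B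
      using that card_subset_eq[of A B] A fins by auto
    have "\<one> \<notin> restricted_sumset G h A"
    proof
      assume "\<one> \<in> restricted_sumset G h A"
      then obtain B where "\<one> = total B" "B \<subseteq> A" "card B = h"
        unfolding restricted_sumset_def by blast
      then show False using eq A(3) by metis
    qed
    then have "?free A" using A(1) by blast
    then have "card A \<in> ?S" by blast
    then have "h \<in> ?S" unfolding A(2) .
    then have "Max ?S = h" using le' finS by (intro Max_eqI) auto
    then show ?thesis using False unfolding max_restricted_zero_sum_free_def by simp
  qed
qed

end

theorem theorem4p4:
  fixes G :: "('a, 'b) monoid_scheme" and n q l h :: nat
  assumes "comm_group G" and "finite (carrier G)"
    and "n = order G"
    and "q = group_exponent G"
    and "\<not> is_elementary_abelian_2_group G"
    and "l = card (order_at_most_2 G)"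
    and "(real n + real l) / 2 - 1 \<le> real h"
    and "real h \<le> real n - 2"
  shows "max_restricted_zero_sum_free G h =
    (if (real h = real n - 3 \<and> q = 3) \<or> (real h = real n - 2 \<and> l = 2 \<and> q mod 4 = 2)
     then h else h + 1)"
proof -
  interpret comm_group G by fact
  note fin = \<open>finite (carrier G)\<close>
  define m where "m = n - h - 1"
  have l: "l = card (sqrts \<one>\<^bsub>G\<^esub>)" using assms(6) order_at_most_2_eq[OF fin] by simp
  have "\<one>\<^bsub>G\<^esub> \<in> sqrts \<one>\<^bsub>G\<^esub>" by simp
  then have lpos: "0 < l" using l fin card_gt_0_iff[of "sqrts \<one>\<^bsub>G\<^esub>"] by auto
  \<comment> \<open>Cleared of the division and the subtraction, the real hypotheses become
    inequalities between casts and so carry over to natural numbers.\<close>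
  have "real (n + l) \<le> real (2 * h + 2)" "real (h + 2) \<le> real n"
    using assms(7,8) by (simp_all add: field_simps)
  then have nl: "n + l \<le> 2 * h + 2" "h + 2 \<le> n" by (simp_all only: of_nat_le_iff)
  then have m: "1 \<le> m" "2 * m + l \<le> n" "n = (h + 1) + m" by (auto simp: m_def)
  \<comment> \<open>Combining both inequalities of \<open>nl\<close> gives \<open>l \<le> h\<close>,
    and \<open>l\<close> is positive because \<open>\<one>\<close> is counted in it.\<close>
  have h: "0 < h" "h < n" using nl lpos by linarith+
  have "(\<exists>A\<subseteq>carrier G. card A = h + 1 \<and> total A \<notin> A) \<longleftrightarrow>
      \<not> (m = 2 \<and> q = 3 \<or> m = 1 \<and> l = 2 \<and> q mod 4 = 2)"
    using ex_total_notin_iff[OF fin, of "h + 1" m] ex_set_mult_total_carrier_iff[OF fin m(1)] m assms(3,4) l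
    by simp
  moreover have "m = 2 \<longleftrightarrow> real h = real n - 3" "m = 1 \<longleftrightarrow> real h = real n - 2"
    using m(3) by auto
  ultimately show ?thesis
    using max_restricted_zero_sum_free_eq[OF fin, of h] h nl assms(3) l by auto
qed

end
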